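(* Consider the network model with infinite buffers (that is, $s_i=\infty$ for all $i$), and suppose that the graph $\mathcal{G}_0=(\mathbf{N},\mathbf{A}_0)$ associated with the matrix $G_0$ is acyclic. Let $p$ be the length (number of arcs) of the longest path in $\mathcal{G}_0$. Then, for every $k=1,2,\ldots$, the implicit equation $$ d(k)=\mathcal{T}_k\otimes G_0^{T}\otimes d(k)\;\oplus\;\mathcal{T}_k\otimes d(k-1)\;\oplus\;\mathcal{T}_k\otimes\bigoplus_{m=1}^{M}G_m^{T}\otimes d(k-m) $$ can be solved for $d(k)$ (i.e., with the vectors $d(k-1),\ldots,d(k-M)$ given, it determines $d(k)$) to produce the explicit state dynamic equation $$ d(k)=\bigoplus_{m=1}^{M}T_m(k)\otimes d(k-m), $$ with the state transition matrices $$ T_1(k)=(E\oplus\mathcal{T}_k\otimes G_0^{T})^{p}\otimes\mathcal{T}_k\otimes(E\oplus G_1^{T}), $$ $$ T_m(k)=(E\oplus\mathcal{T}_k\otimes G_0^{T})^{p}\otimes\mathcal{T}_k\otimes G_m^{T},\qquad m=2,\ldots,M. $$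
   Context: Max-plus algebra: $\underline{\mathbb{R}}=\mathbb{R}\cup\{\varepsilon\}$ with $\varepsilon=-\infty$, $x\oplus y=\max(x,y)$, $x\otimes y=x+y$ (with $x\otimes\varepsilon=\varepsilon\otimes x=\varepsilon$), and identity element $e=0$. For matrices and vectors over $\underline{\mathbb{R}}$, $\oplus$ is entrywise and $(X\otimes Y)_{ij}=\bigoplus_k x_{ik}\otimes y_{kj}$, where $\bigoplus$ is iterated $\oplus$. The null matrix $\mathcal{E}$ has all entries $\varepsilon$; the identity matrix $E$ has diagonal entries $e$ and off-diagonal entries $\varepsilon$. Powers: $X^0=E$, $X^q=X\otimes\cdots\otimes X$ ($q$ factors). $X^T$ is the transpose. The graph associated with an $n\times n$ matrix $X$ is the oriented graph on $\{1,\ldots,n\}$ having arc $(i,j)$ if and only if $x_{ij}\ne\varepsilon$; it is acyclic if it has no oriented circuit. Network model: the network has $n$ single-server first-come-first-served nodes and topology given by an oriented graph $\mathcal{G}=(\mathbf{N},\mathbf{A})$, $\mathbf{N}=\{1,\ldots,n\}$, $\mathbf{A}\subset\mathbf{N}\times\mathbf{N}$ (not necessarily acyclic), where $(i,j)\in\mathbf{A}$ iff node $i$ passes customers directly to node $j$. Put $\mathbf{P}(i)=\{j:(j,i)\in\mathbf{A}\}$ and $\mathbf{S}(i)=\{j:(i,j)\in\mathbf{A}\}$. Node $i$ has a buffer of capacity $s_i$ and initially $r_i$ customers in it, $0\le r_i\le s_i\le\infty$, with $r_i=s_i=\infty$ whenever $\mathbf{P}(i)=\emptyset$. The service time of the $k$th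 customer at node $i$ is a given real $\tau_{ik}>0$. The variables $a_i(k),b_i(k),c_i(k),d_i(k)$ are the $k$th arrival, service initiation, service completion and departure epochs at node $i$; $d_i(0)=e$ and $d_i(k)=\varepsilon$ for $k<0$. With infinite buffers the fork-join dynamics are $a_i(k)=\bigoplus_{j\in\mathbf{P}(i)}d_j(k-r_i)$ if $\mathbf{P}(i)\neq\emptyset$, $a_i(k)=\varepsilon$ if $\mathbf{P}(i)=\emptyset$; $b_i(k)=a_i(k)\oplus d_i(k-1)$; $c_i(k)=\tau_{ik}\otimes b_i(k)$; $d_i(k)=c_i(k)$. The implicit equation in the claim is the vector form of these equations. Notation: $d(k)=(d_1(k),\ldots,d_n(k))^T\in\underline{\mathbb{R}}^n$. $\mathcal{T}_k$ is the $n\times n$ matrix with diagonal entries $\tau_{1k},\ldots,\tau_{nk}$ and off-diagonal entries $\varepsilon$. $M_r=\max\{r_i: r_i<\infty\}$ (taken as $0$ if no $r_i$ is finite), and $M=\max(M_r,1)$. For $m=0,1,\ldots,M$, $G_m=(g^m_{ij})$ is the $n\times n$ matrix with $g^m_{ij}=e$ if $i\in\mathbf{P}(j)$ and $m=r_j$, and $g^m_{ij}=\varepsilon$ otherwise (so $G_m=\mathcal{E}$ for $m>M_r$). The graph associated with $G_0$ is $\mathcal{G}_0=(\mathbf{N},\mathbf{A}_0)$, $\mathbf{A}_0=\{(i,j): i\in\mathbf{P}(j),\ r_j=0\}$. *)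

theory Defs
  imports "HOL-Analysis.Analysis" "HOL-Library.Extended_Nat"
begin

section \<open>The max-plus semiring\<close>

text \<open>
  The max-plus operations are made the semiring operations of the type, so that the library's
  vectors, matrices, matrix products and finite sums become the max-plus ones.  Reading guide:
  \<open>+\<close> and \<open>\<Sum>\<close> are max-plus addition (maximum), \<open>*\<close> is max-plus multiplication (addition of
  reals), \<open>0\<close> is the null element \<open>\<epsilon> = -\<infinity>\<close>, and \<open>1\<close> is the identity element \<open>e\<close>, the real
  number zero.  Consequently \<open>mat 1\<close> is the identity matrix \<open>E\<close>, and \<open>0\<close> is the null matrix.
\<close>

datatype maxplus = Eps | Fin real

instantiation maxplus :: comm_semiring_1
begin

definition zero_maxplus :: maxplus where "0 = Eps"

definition one_maxplus :: maxplus where "1 = Fin 0"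

fun plus_maxplus :: "maxplus \<Rightarrow> maxplus \<Rightarrow> maxplus" where
  "Eps + y = y"
| "x + Eps = x"
| "Fin x + Fin y = Fin (max x y)"

fun times_maxplus :: "maxplus \<Rightarrow> maxplus \<Rightarrow> maxplus" where
  "Eps * y = Eps"
| "x * Eps = Eps"
| "Fin x * Fin y = Fin (x + y)"

instance
proof
  fix x y z :: maxplus
  show "x + y + z = x + (y + z)"
    by (cases x; cases y; cases z) (simp_all add: max.assoc)
  show "x + y = y + x"
    by (cases x; cases y) (simp_all add: max.commute)
  show "0 + x = x"
    by (simp add: zero_maxplus_def)
  show "x * y * z = x * (y * z)"
    by (cases x; cases y; cases z) simp_all
  show "x * y = y * x"
    by (cases x; cases y) simp_all
  show "1 * x = x"
    by (cases x) (simp_all add: one_maxplus_def)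
  show "0 * x = 0" "x * 0 = 0"
    by (cases x; simp add: zero_maxplus_def)+
  show "(x + y) * z = x * z + y * z"
    by (cases x; cases y; cases z) (simp_all add: max_add_distrib_left)
  show "(0 :: maxplus) \<noteq> 1"
    by (simp add: zero_maxplus_def one_maxplus_def)
qed

end

primrec mpow :: "'a::semiring_1 ^ 'n ^ 'n \<Rightarrow> nat \<Rightarrow> 'a ^ 'n ^ 'n" where
  "mpow X 0 = mat 1"
| "mpow X (Suc q) = X ** mpow X q"


section \<open>Graphs\<close>

definition assoc_graph :: "maxplus ^ 'n ^ 'n \<Rightarrow> ('n \<times> 'n) set" where
  "assoc_graph X = {(i, j). X $ i $ j \<noteq> 0}"

text \<open>A path is given by its list of pairwise distinct vertices; its length is the number of arcs.\<close>

definition graph_paths :: "('n \<times> 'n) set \<Rightarrow> 'n list set" where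
  "graph_paths A = {xs. xs \<noteq> [] \<and> distinct xs \<and> successively (\<lambda>i j. (i, j) \<in> A) xs}"

definition longest_path_length :: "('n::finite \<times> 'n) set \<Rightarrow> nat" where
  "longest_path_length A = Max ((\<lambda>xs. length xs - 1) ` graph_paths A)"

definition preds :: "('n \<times> 'n) set \<Rightarrow> 'n \<Rightarrow> 'n set" where
  "preds A i = {j. (j, i) \<in> A}"


section \<open>Fork-join networks\<close>

text \<open>
  The nodes are the elements of the finite type \<open>'n\<close>; \<open>A\<close> is the set of arcs, \<open>s\<close> the buffer
  capacities, \<open>r\<close> the initial numbers of customers and \<open>\<tau> i k\<close> the service time of the
  \<open>k\<close>-th customer at node \<open>i\<close>, for \<open>k \<ge> 1\<close>.
\<close>

definition fork_join_network ::
  "('n::finite \<times> 'n) set \<Rightarrow> ('n \<Rightarrow> enat) \<Rightarrow> ('n \<Rightarrow> enat) \<Rightarrow> ('n \<Rightarrow> nat \<Rightarrow> real) \<Rightarrow> bool" where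
  "fork_join_network A s r \<tau> \<longleftrightarrow>
     (\<forall>i. r i \<le> s i) \<and>
     (\<forall>i. preds A i = {} \<longrightarrow> r i = \<infinity> \<and> s i = \<infinity>) \<and>
     (\<forall>i k. k \<ge> 1 \<longrightarrow> \<tau> i k > 0)"

text \<open>
  The departure epoch with index \<open>k - m\<close>.  For \<open>m = \<infinity>\<close> the index is \<open>-\<infinity>\<close>, so the value is
  \<open>\<epsilon>\<close>, as for every negative index.
\<close>

definition delayed :: "(int \<Rightarrow> maxplus ^ 'n) \<Rightarrow> 'n \<Rightarrow> nat \<Rightarrow> enat \<Rightarrow> maxplus" where
  "delayed d j k m = (case m of enat m' \<Rightarrow> d (int k - int m') $ j | \<infinity> \<Rightarrow> 0)"

text \<open>
  The evolution of the network when all buffers are infinite.  The condition for the arrival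
  epochs also covers nodes without predecessors, for which the sum is empty, that is, \<open>\<epsilon>\<close>.
\<close>

definition fork_join_dynamics ::
  "('n::finite \<times> 'n) set \<Rightarrow> ('n \<Rightarrow> enat) \<Rightarrow> ('n \<Rightarrow> nat \<Rightarrow> real) \<Rightarrow>
   ('n \<Rightarrow> nat \<Rightarrow> maxplus) \<Rightarrow> ('n \<Rightarrow> nat \<Rightarrow> maxplus) \<Rightarrow> ('n \<Rightarrow> nat \<Rightarrow> maxplus) \<Rightarrow>
   (int \<Rightarrow> maxplus ^ 'n) \<Rightarrow> bool" where
  "fork_join_dynamics A r \<tau> a b c d \<longleftrightarrow>
     (\<forall>i. d 0 $ i = 1) \<and>
     (\<forall>k<0. \<forall>i. d k $ i = 0) \<and>
     (\<forall>k\<ge>1. \<forall>i.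
        a i k = (\<Sum>j\<in>preds A i. delayed d j k (r i)) \<and>
        b i k = a i k + d (int k - 1) $ i \<and>
        c i k = Fin (\<tau> i k) * b i k \<and>
        d (int k) $ i = c i k)"

definition service_mat :: "('n::finite \<Rightarrow> nat \<Rightarrow> real) \<Rightarrow> nat \<Rightarrow> maxplus ^ 'n ^ 'n" where
  "service_mat \<tau> k = (\<chi> i j. if i = j then Fin (\<tau> i k) else 0)"

definition max_delay :: "('n::finite \<Rightarrow> enat) \<Rightarrow> nat" where
  "max_delay r =
     max (if \<exists>i. r i \<noteq> \<infinity> then Max {m. \<exists>i. r i = enat m} else 0) 1"

definition G :: "('n::finite \<times> 'n) set \<Rightarrow> ('n \<Rightarrow> enat) \<Rightarrow> nat \<Rightarrow> maxplus ^ 'n ^ 'n" where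
  "G A r m = (\<chi> i j. if i \<in> preds A j \<and> r j = enat m then 1 else 0)"

lemma assoc_graph_G: "assoc_graph (G A r 0) = {(i, j). i \<in> preds A j \<and> r j = 0}"
  by (auto simp: assoc_graph_def G_def zero_enat_def)

text \<open>
  The right-hand side of the implicit equation at step \<open>k\<close>, with \<open>x\<close> in place of the unknown
  \<open>d k\<close>; only the values \<open>d (k - 1), \<dots>, d (k - M)\<close> of \<open>d\<close> are used.
\<close>

definition implicit_rhs ::
  "('n::finite \<times> 'n) set \<Rightarrow> ('n \<Rightarrow> enat) \<Rightarrow> ('n \<Rightarrow> nat \<Rightarrow> real) \<Rightarrow> nat \<Rightarrow>
   (int \<Rightarrow> maxplus ^ 'n) \<Rightarrow> maxplus ^ 'n \<Rightarrow> maxplus ^ 'n" where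
  "implicit_rhs A r \<tau> k d x =
     service_mat \<tau> k ** transpose (G A r 0) *v x
     + service_mat \<tau> k *v d (int k - 1)
     + service_mat \<tau> k *v (\<Sum>m = 1..max_delay r. transpose (G A r m) *v d (int k - int m))"

definition transition_mat ::
  "('n::finite \<times> 'n) set \<Rightarrow> ('n \<Rightarrow> enat) \<Rightarrow> ('n \<Rightarrow> nat \<Rightarrow> real) \<Rightarrow> nat \<Rightarrow> nat \<Rightarrow> nat \<Rightarrow>
   maxplus ^ 'n ^ 'n" where
  "transition_mat A r \<tau> p m k =
     mpow (mat 1 + service_mat \<tau> k ** transpose (G A r 0)) p ** service_mat \<tau> k **
     (if m = 1 then mat 1 + transpose (G A r 1) else transpose (G A r m))"

end

theory Submission
  imports Defs
begin

text \<open>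
  Write \<open>N = \<T>\<^sub>k \<otimes> G\<^sub>0\<^sup>T\<close>.  The implicit equation has the form \<open>x = N \<otimes> x \<oplus> w\<close>, where \<open>w\<close>
  depends only on the earlier epochs.  Substituting the equation into itself \<open>p\<close> times gives
  \<open>x = N\<^bsup>p+1\<^esup> \<otimes> x \<oplus> (E \<oplus> N \<oplus> \<dots> \<oplus> N\<^bsup>p\<^esup>) \<otimes> w\<close>, and since \<open>\<oplus>\<close> is idempotent the bracket is
  \<open>(E \<oplus> N)\<^bsup>p\<^esup>\<close>.

  The remainder vanishes because of the graph.  An entry of \<open>N\<^sup>q\<close> other than \<open>\<epsilon>\<close> yields a walk with
  \<open>q\<close> arcs in \<open>\<G>\<^sub>0\<close> (\<open>mpow_nonzero_walk\<close>).  In an acyclic graph a walk does not repeat a vertex,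
  hence it is a path and \<open>q \<le> p\<close>.  So \<open>N\<^bsup>p+1\<^esup> = \<E>\<close> (\<open>mpow_eq_0_of_acyclic\<close>), which makes
  \<open>(E \<oplus> N)\<^bsup>p\<^esup> \<otimes> w\<close> the only candidate for a solution, and also makes it a solution
  (\<open>fixpoint_iff_mpow\<close>).  Distributing \<open>(E \<oplus> N)\<^bsup>p\<^esup>\<close> over \<open>w\<close> gives the transition matrices.

  That the departure epochs of the network satisfy the implicit equation is a regrouping of the
  arrival epochs by their delays (\<open>arrival_eq_sum_G\<close>).
\<close>

section \<open>Linear fixpoint equations over an idempotent semiring\<close>

lemma matrix_vector_mult_sum:
  fixes X :: "'a::semiring_1 ^ 'n ^ 'm"
  shows "X *v (\<Sum>i\<in>I. f i) = (\<Sum>i\<in>I. X *v f i)"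
  by (induction I rule: infinite_finite_induct) (simp_all add: matrix_vector_right_distrib)

lemma matrix_add_rdistrib: "(A + B) ** C = A ** C + B ** (C :: 'a::semiring_1 ^ 'n ^ 'm)"
  by (simp add: vec_eq_iff matrix_matrix_mult_def distrib_right sum.distrib)

text \<open>
  These are the Horner form of \<open>(E \<oplus> N)\<^bsup>q\<^esup> = E \<oplus> N \<oplus> \<dots> \<oplus> N\<^bsup>q\<^esup>\<close> and its recursion at the top
  degree; they carry everything that is used of that identity.
\<close>

lemma mpow_one_plus_Suc:
  fixes N :: "'a::semiring_1 ^ 'n ^ 'n"
  assumes idem: "\<And>x :: 'a. x + x = x"
  shows "mpow (mat 1 + N) (Suc q) = mat 1 + N ** mpow (mat 1 + N) q"
proof (induction q)
  case 0
  show ?case by simp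
next
  case (Suc q)
  let ?S = "mpow (mat 1 + N)"
  have idem': "X + X = X" for X :: "'a ^ 'n ^ 'n"
    by (simp add: vec_eq_iff idem)
  \<comment> \<open>\<open>N \<otimes> S\<^bsub>q+1\<^esub>\<close> absorbs \<open>N \<otimes> S\<^bsub>q\<^esub>\<close>, because it contains it as a summand.\<close>
  have absorb: "N ** ?S q + N ** ?S (Suc q) = N ** ?S (Suc q)"
    by (simp add: matrix_add_rdistrib matrix_add_ldistrib add.assoc[symmetric] idem')
  have "?S (Suc (Suc q)) = ?S (Suc q) + N ** ?S (Suc q)"
    by (simp add: matrix_add_rdistrib)
  also have "\<dots> = mat 1 + (N ** ?S q + N ** ?S (Suc q))"
    by (simp only: Suc.IH add.assoc)
  finally show ?case
    by (simp only: absorb)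
qed

lemma mpow_one_plus_top:
  fixes N :: "'a::semiring_1 ^ 'n ^ 'n"
  assumes idem: "\<And>x :: 'a. x + x = x"
  shows "mpow (mat 1 + N) (Suc q) = mpow (mat 1 + N) q + mpow N (Suc q)"
proof (induction q)
  case 0
  show ?case by simp
next
  case (Suc q)
  note horner = mpow_one_plus_Suc[OF idem]
  have "mpow (mat 1 + N) (Suc (Suc q)) = mat 1 + N ** (mpow (mat 1 + N) q + mpow N (Suc q))"
    using Suc.IH by (simp only: horner[of N "Suc q"])
  also have "\<dots> = (mat 1 + N ** mpow (mat 1 + N) q) + mpow N (Suc (Suc q))"
    by (simp add: matrix_add_ldistrib add.assoc)
  finally show ?case
    by (simp only: horner[of N q])
qed

lemma fixpoint_unfold:
  fixes N :: "'a::semiring_1 ^ 'n ^ 'n"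
  assumes idem: "\<And>x :: 'a. x + x = x" and x: "x = N *v x + w"
  shows "x = mpow N (Suc q) *v x + mpow (mat 1 + N) q *v w"
proof (induction q)
  case 0
  show ?case using x by simp
next
  case (Suc q)
  have "x = N *v (mpow N (Suc q) *v x + mpow (mat 1 + N) q *v w) + w"
    using x Suc.IH by simp
  also have "\<dots> = mpow N (Suc (Suc q)) *v x + (mat 1 + N ** mpow (mat 1 + N) q) *v w"
    by (simp add: matrix_vector_right_distrib matrix_vector_mult_add_rdistrib
        matrix_vector_mul_assoc matrix_mul_assoc ac_simps)
  finally show ?case
    by (simp only: mpow_one_plus_Suc[OF idem])
qed

text \<open>
  Nilpotency is used twice: it removes the remainder of the unfolded equation, which gives
  uniqueness, and it stops the growth of \<open>(E \<oplus> N)\<^bsup>q\<^esup>\<close> at \<open>q = p\<close>, which gives existence.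
\<close>

lemma fixpoint_iff_mpow:
  fixes N :: "'a::semiring_1 ^ 'n ^ 'n"
  assumes idem: "\<And>x :: 'a. x + x = x" and nilp: "mpow N (Suc p) = 0"
  shows "x = N *v x + w \<longleftrightarrow> x = mpow (mat 1 + N) p *v w"
proof
  assume "x = N *v x + w"
  from fixpoint_unfold[OF idem this, of p] show "x = mpow (mat 1 + N) p *v w"
    by (simp only: nilp matrix_vector_mult_0 add_0)
next
  assume x: "x = mpow (mat 1 + N) p *v w"
  have "mpow (mat 1 + N) p = mpow (mat 1 + N) (Suc p)"
    by (simp only: mpow_one_plus_top[OF idem] nilp add_0_right)
  also have "\<dots> = mat 1 + N ** mpow (mat 1 + N) p"
    by (rule mpow_one_plus_Suc[OF idem])
  finally have "x = (mat 1 + N ** mpow (mat 1 + N) p) *v w"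
    using x by simp
  also have "\<dots> = N *v x + w"
    by (simp add: x matrix_vector_mult_add_rdistrib matrix_vector_mul_assoc add.commute)
  finally show "x = N *v x + w" .
qed

section \<open>Nilpotency from acyclicity\<close>

lemma distinct_of_acyclic_walk:
  assumes "acyclic R" and "successively (\<lambda>i j. (i, j) \<in> R) xs"
  shows "distinct xs"
proof -
  have "successively (\<lambda>i j. (i, j) \<in> R\<^sup>+) xs"
    using assms(2) by (rule successively_mono) auto
  moreover have "transp (\<lambda>i j. (i, j) \<in> R\<^sup>+)"
    by (auto intro: transpI trancl_trans)
  ultimately have "sorted_wrt (\<lambda>i j. (i, j) \<in> R\<^sup>+) xs"
    by (simp add: successively_conv_sorted_wrt)
  then show ?thesis
    using assms(1) by (induction xs) (auto simp: acyclic_def)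
qed

text \<open>
  A nonzero entry of \<open>N \<otimes> N\<^sup>q\<close> has a nonzero summand, whose first factor is an arc that prolongs
  the walk belonging to the second one.  The arcs are taken against the direction of the entries, \<open>(j, i)\<close> for the entry in row \<open>i\<close> and
  column \<open>j\<close>, since the matrix to which this is applied is built from the transpose of \<open>G\<^sub>0\<close>.
\<close>

lemma mpow_nonzero_walk:
  fixes N :: "'a::semiring_1 ^ 'n::finite ^ 'n"
  assumes arcs: "\<And>i j. N $ i $ j \<noteq> 0 \<Longrightarrow> (j, i) \<in> R"
    and "mpow N q $ i $ j \<noteq> 0"
  shows "\<exists>xs. length xs = Suc q \<and> last xs = i \<and> successively (\<lambda>i j. (i, j) \<in> R) xs"
  using assms(2)
proof (induction q arbitrary: i)
  case 0
  show ?case by (rule exI[of _ "[i]"]) simp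
next
  case (Suc q)
  have "(\<Sum>l\<in>UNIV. N $ i $ l * mpow N q $ l $ j) \<noteq> 0"
    using Suc.prems by (simp add: matrix_matrix_mult_def)
  then obtain l where "N $ i $ l * mpow N q $ l $ j \<noteq> 0"
    by (meson sum.neutral)
  then have l: "(l, i) \<in> R" "mpow N q $ l $ j \<noteq> 0"
    using arcs by (metis mult_zero_left, metis mult_zero_right)
  from Suc.IH[OF l(2)] obtain xs where
    "length xs = Suc q" "last xs = l" "successively (\<lambda>i j. (i, j) \<in> R) xs" by blast
  then show ?case
    using l(1) by (intro exI[of _ "xs @ [i]"]) (auto simp: successively_append_iff)
qed

text \<open>
  Paths repeat no vertex, so there are finitely many and the maximum in the definition of the
  longest path length is attained.
\<close>

lemma length_path_le_longest:
  fixes R :: "('n::finite \<times> 'n) set"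
  assumes "xs \<in> graph_paths R"
  shows "length xs - 1 \<le> longest_path_length R"
proof -
  have "graph_paths R \<subseteq> {xs. set xs \<subseteq> UNIV \<and> length xs \<le> CARD('n)}"
    by (auto simp: graph_paths_def distinct_card[symmetric] intro!: card_mono)
  then have "finite (graph_paths R)"
    using finite_lists_length_le[of "UNIV :: 'n set"] finite_subset by fastforce
  then show ?thesis
    unfolding longest_path_length_def using assms by (intro Max_ge) auto
qed

lemma mpow_eq_0_of_acyclic:
  fixes N :: "'a::semiring_1 ^ 'n::finite ^ 'n"
  assumes "\<And>i j. N $ i $ j \<noteq> 0 \<Longrightarrow> (j, i) \<in> R" and "acyclic R"
  shows "mpow N (Suc (longest_path_length R)) = 0"
proof (rule ccontr)
  assume "mpow N (Suc (longest_path_length R)) \<noteq> 0"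
  then obtain i j where "mpow N (Suc (longest_path_length R)) $ i $ j \<noteq> 0"
    by (metis vec_eq_iff zero_index)
  then obtain xs where len: "length xs = Suc (Suc (longest_path_length R))"
    and walk: "successively (\<lambda>i j. (i, j) \<in> R) xs"
    using mpow_nonzero_walk[OF assms(1)] by blast
  have "xs \<in> graph_paths R"
    using len walk distinct_of_acyclic_walk[OF assms(2) walk] by (auto simp: graph_paths_def)
  from length_path_le_longest[OF this] len show False by simp
qed

section \<open>The state equation of the network\<close>

lemma maxplus_add_idem: "x + x = (x :: maxplus)"
  by (cases x) simp_all

lemma service_mat_mult_vec: "(service_mat \<tau> k *v v) $ i = Fin (\<tau> i k) * v $ i"
  by (simp add: matrix_vector_mult_def service_mat_def if_distribR if_distrib[of "\<lambda>t. t * _"]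
      cong: if_cong)

lemma service_mat_mult_mat:
  "(service_mat \<tau> k ** X) $ i $ j = Fin (\<tau> i k) * X $ i $ j"
  by (simp add: matrix_matrix_mult_def service_mat_def if_distribR if_distrib[of "\<lambda>t. t * _"]
      cong: if_cong)

lemma le_max_delay:
  assumes "r i = enat m"
  shows "m \<le> max_delay r"
proof -
  have "{m. \<exists>i. r i = enat m} \<subseteq> (\<lambda>i. the_enat (r i)) ` UNIV"
    by (auto simp: image_iff) (metis the_enat.simps)
  then have "finite {m. \<exists>i. r i = enat m}"
    by (rule finite_subset) simp
  then have "m \<le> Max {m. \<exists>i. r i = enat m}"
    using assms by (intro Max_ge) auto
  then show ?thesis
    using assms unfolding max_delay_def by (auto simp: max_def)
qed

lemma transpose_G_mult_vec:
  "(transpose (G A r m) *v v) $ i = (if r i = enat m then \<Sum>j\<in>preds A i. v $ j else 0)"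
proof -
  have "(transpose (G A r m) *v v) $ i
    = (\<Sum>j\<in>UNIV. if j \<in> preds A i \<and> r i = enat m then v $ j else 0)"
    unfolding matrix_vector_mult_def transpose_def G_def
    by (simp add: if_distrib[of "\<lambda>t. t * _"] cong: if_cong)
  also have "\<dots> = (if r i = enat m then \<Sum>j\<in>preds A i. v $ j else 0)"
    by (simp add: sum.If_cases)
  finally show ?thesis .
qed

text \<open>
  Node \<open>i\<close> has a single delay \<open>r\<^sub>i\<close>.  If it is finite, it is one of \<open>0, \<dots>, M\<close>, and \<open>G\<^sub>m\<^sup>T\<close> has a
  nonzero row \<open>i\<close> at most for \<open>m = r\<^sub>i\<close>; if it is infinite, both sides are \<open>\<epsilon>\<close>.
\<close>

lemma arrival_eq_sum_G:
  "(\<Sum>j\<in>preds A i. delayed d j k (r i))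
   = (\<Sum>m = 0..max_delay r. transpose (G A r m) *v d (int k - int m)) $ i"
proof (cases "r i")
  case (enat m')
  then have "m' \<in> {0..max_delay r}"
    using le_max_delay by simp
  then show ?thesis
    by (simp add: enat transpose_G_mult_vec delayed_def del: transpose_matrix_vector)
next
  case infinity
  then show ?thesis
    by (simp add: transpose_G_mult_vec delayed_def del: transpose_matrix_vector)
qed

lemma dynamics_imp_implicit_eq:
  assumes "fork_join_dynamics A r \<tau> a b c d" and "k \<ge> 1"
  shows "d (int k) = implicit_rhs A r \<tau> k d (d (int k))"
proof -
  have "d (int k) $ i = implicit_rhs A r \<tau> k d (d (int k)) $ i" for i
  proof -
    have "d (int k) $ i
      = Fin (\<tau> i k) * ((\<Sum>j\<in>preds A i. delayed d j k (r i)) + d (int k - 1) $ i)"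
      using assms unfolding fork_join_dynamics_def by metis
    also have "\<dots> = implicit_rhs A r \<tau> k d (d (int k)) $ i"
      unfolding arrival_eq_sum_G implicit_rhs_def
      by (simp add: sum.atLeast_Suc_atMost[of 0] service_mat_mult_vec
          matrix_vector_mul_assoc[symmetric] distrib_left ac_simps
          del: transpose_matrix_vector)
    finally show ?thesis .
  qed
  then show ?thesis by (simp add: vec_eq_iff)
qed

text \<open>
  The term \<open>\<T>\<^sub>k \<otimes> d(k-1)\<close>, which expresses that a server is occupied until its previous
  customer has left, has the same delay as \<open>\<T>\<^sub>k \<otimes> G\<^sub>1\<^sup>T \<otimes> d(k-1)\<close>; merging the two produces
  the exceptional form of \<open>T\<^sub>1(k)\<close>.
\<close>

lemma transition_sum_eq:
  "(\<Sum>m = 1..max_delay r. transition_mat A r \<tau> p m k *v d (int k - int m))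
   = mpow (mat 1 + service_mat \<tau> k ** transpose (G A r 0)) p *v
      (service_mat \<tau> k *v d (int k - 1)
       + service_mat \<tau> k *v (\<Sum>m = 1..max_delay r. transpose (G A r m) *v d (int k - int m)))"
proof -
  let ?S = "mpow (mat 1 + service_mat \<tau> k ** transpose (G A r 0)) p"
  let ?g = "\<lambda>m. transpose (G A r m) *v d (int k - int m)"
  let ?h = "\<lambda>m. (if m = 1 then mat 1 + transpose (G A r 1) else transpose (G A r m))
              *v d (int k - int m)"
  \<comment> \<open>The index \<open>1\<close> always occurs, because \<open>M \<ge> 1\<close> even when no \<open>r\<^sub>i\<close> is positive and finite.\<close>
  have split: "{1..max_delay r} = insert 1 {2..max_delay r}"
    unfolding max_delay_def by auto
  have "(\<Sum>m = 1..max_delay r. ?h m) = d (int k - 1) + (\<Sum>m = 1..max_delay r. ?g m)"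
    unfolding split
    by (simp add: matrix_vector_mult_add_rdistrib add.assoc del: transpose_matrix_vector)
  then show ?thesis
    unfolding transition_mat_def
    by (simp add: matrix_vector_mul_assoc[symmetric] matrix_vector_mult_sum[symmetric]
        matrix_vector_right_distrib[symmetric] del: transpose_matrix_vector)
qed


theorem theorem2:
  fixes A :: "('n::finite \<times> 'n) set"
    and s r :: "'n \<Rightarrow> enat"
    and \<tau> :: "'n \<Rightarrow> nat \<Rightarrow> real"
    and p :: nat
  assumes "fork_join_network A s r \<tau>"
    and "\<forall>i. s i = \<infinity>"
    and "acyclic (assoc_graph (G A r 0))"
    and "p = longest_path_length (assoc_graph (G A r 0))"
  shows "(\<forall>k\<ge>1. \<forall>(d :: int \<Rightarrow> maxplus ^ 'n) x.
            x = implicit_rhs A r \<tau> k d x \<longleftrightarrow>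
            x = (\<Sum>m = 1..max_delay r. transition_mat A r \<tau> p m k *v d (int k - int m)))
       \<and> (\<forall>a b c d. fork_join_dynamics A r \<tau> a b c d \<longrightarrow>
            (\<forall>k\<ge>1. d (int k) = implicit_rhs A r \<tau> k d (d (int k)) \<and>
               d (int k) =
                 (\<Sum>m = 1..max_delay r. transition_mat A r \<tau> p m k *v d (int k - int m))))"
proof -
  have explicit: "x = implicit_rhs A r \<tau> k d x \<longleftrightarrow>
      x = (\<Sum>m = 1..max_delay r. transition_mat A r \<tau> p m k *v d (int k - int m))"
    for k and d :: "int \<Rightarrow> maxplus ^ 'n" and x
  proof -
    let ?N = "service_mat \<tau> k ** transpose (G A r 0)"
    have "(j, i) \<in> assoc_graph (G A r 0)" if "?N $ i $ j \<noteq> 0" for i j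
      using that by (auto simp: service_mat_mult_mat assoc_graph_def transpose_def)
    then have "mpow ?N (Suc p) = 0"
      unfolding assms(4) using assms(3) by (intro mpow_eq_0_of_acyclic)
    from fixpoint_iff_mpow[OF maxplus_add_idem this] show ?thesis
      unfolding implicit_rhs_def transition_sum_eq by (simp only: add.assoc)
  qed
  moreover have "d (int k) = implicit_rhs A r \<tau> k d (d (int k))"
    if "fork_join_dynamics A r \<tau> a b c d" "k \<ge> 1" for a b c d k
    using that by (rule dynamics_imp_implicit_eq)
  ultimately show ?thesis by blast
qed

end
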